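(* A temporal relation $R$ is preserved by $\mathrm{pp}$ if and only if it can be defined as a conjunction of clauses of the form $$x \neq y_1 \vee \cdots \vee x \neq y_k \vee x \geq z_1 \vee \cdots \vee x \geq z_l,$$ where it is permitted that $l = 0$ or $k = 0$, in which cases the clause is a disjunction of disequalities or contains no disequalities, respectively.
   Context: A temporal relation is a relation on $\mathbb{Q}$ that is first-order definable over $(\mathbb{Q};<)$. A function $f\colon \mathbb{Q}^k\to\mathbb{Q}$ preserves a relation $R\subseteq\mathbb{Q}^m$ if applying $f$ componentwise to any $k$ tuples of $R$ yields a tuple of $R$. The operation $\mathrm{pp}$ is an arbitrary binary operation on $\mathbb{Q}$ such that $\mathrm{pp}(a,b)\leq \mathrm{pp}(a',b')$ if and only if either ($a\leq 0$ and $a\leq a'$) or ($0<a$, $0<a'$, and $b\leq b'$). *)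

theory Defs
  imports Complex_Main
begin

datatype fo_formula =
    FF
  | Less nat nat
  | Eq nat nat
  | Neg fo_formula
  | And fo_formula fo_formula
  | Or fo_formula fo_formula
  | Exists nat fo_formula
  | Forall nat fo_formula

primrec fv :: "fo_formula \<Rightarrow> nat set" where
  "fv FF = {}"
| "fv (Less x y) = {x, y}"
| "fv (Eq x y) = {x, y}"
| "fv (Neg \<phi>) = fv \<phi>"
| "fv (And \<phi> \<psi>) = fv \<phi> \<union> fv \<psi>"
| "fv (Or \<phi> \<psi>) = fv \<phi> \<union> fv \<psi>"
| "fv (Exists x \<phi>) = fv \<phi> - {x}"
| "fv (Forall x \<phi>) = fv \<phi> - {x}"

primrec holds :: "(nat \<Rightarrow> rat) \<Rightarrow> fo_formula \<Rightarrow> bool" where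
  "holds \<sigma> FF \<longleftrightarrow> False"
| "holds \<sigma> (Less x y) \<longleftrightarrow> \<sigma> x < \<sigma> y"
| "holds \<sigma> (Eq x y) \<longleftrightarrow> \<sigma> x = \<sigma> y"
| "holds \<sigma> (Neg \<phi>) \<longleftrightarrow> \<not> holds \<sigma> \<phi>"
| "holds \<sigma> (And \<phi> \<psi>) \<longleftrightarrow> holds \<sigma> \<phi> \<and> holds \<sigma> \<psi>"
| "holds \<sigma> (Or \<phi> \<psi>) \<longleftrightarrow> holds \<sigma> \<phi> \<or> holds \<sigma> \<psi>"
| "holds \<sigma> (Exists x \<phi>) \<longleftrightarrow> (\<exists>q. holds (\<sigma>(x := q)) \<phi>)"
| "holds \<sigma> (Forall x \<phi>) \<longleftrightarrow> (\<forall>q. holds (\<sigma>(x := q)) \<phi>)"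

text \<open>
  An \<open>m\<close>-ary relation on the rationals is a set of lists of length \<open>m\<close>; the \<open>i\<close>-th entry
  interprets the variable \<open>i\<close>. The value of \<open>t ! i\<close> for \<open>i \<ge> m\<close> is irrelevant,
  because all free variables are required to be below \<open>m\<close>.
\<close>

definition fo_defines :: "nat \<Rightarrow> fo_formula \<Rightarrow> rat list set \<Rightarrow> bool" where
  "fo_defines m \<phi> R \<longleftrightarrow>
     fv \<phi> \<subseteq> {..<m} \<and> R = {t. length t = m \<and> holds (\<lambda>i. t ! i) \<phi>}"

definition temporal_relation :: "nat \<Rightarrow> rat list set \<Rightarrow> bool" where
  "temporal_relation m R \<longleftrightarrow> (\<exists>\<phi>. fo_defines m \<phi> R)"

definition preserves :: "(rat \<Rightarrow> rat \<Rightarrow> rat) \<Rightarrow> rat list set \<Rightarrow> bool" where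
  "preserves f R \<longleftrightarrow> (\<forall>s\<in>R. \<forall>t\<in>R. map2 f s t \<in> R)"

definition is_pp :: "(rat \<Rightarrow> rat \<Rightarrow> rat) \<Rightarrow> bool" where
  "is_pp f \<longleftrightarrow>
     (\<forall>a b a' b'. f a b \<le> f a' b' \<longleftrightarrow>
        (a \<le> 0 \<and> a \<le> a') \<or> (0 < a \<and> 0 < a' \<and> b \<le> b'))"

definition Neq :: "nat \<Rightarrow> nat \<Rightarrow> fo_formula" where
  "Neq x y = Neg (Eq x y)"

definition Geq :: "nat \<Rightarrow> nat \<Rightarrow> fo_formula" where
  "Geq x z = Or (Less z x) (Eq x z)"

definition Disj :: "fo_formula list \<Rightarrow> fo_formula" where
  "Disj \<phi>s = foldr Or \<phi>s FF"

definition Conj :: "fo_formula list \<Rightarrow> fo_formula" where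
  "Conj \<phi>s = foldr And \<phi>s (Neg FF)"

text \<open>
  Both lists may be empty; if both are, the clause is the empty disjunction, which is false
  and in which \<open>x\<close> does not occur.
\<close>

definition pp_clause :: "fo_formula \<Rightarrow> bool" where
  "pp_clause \<phi> \<longleftrightarrow> (\<exists>x ys zs. \<phi> = Disj (map (Neq x) ys @ map (Geq x) zs))"

end

theory Submission
  imports Defs
begin

text \<open>
  Suppose \<open>R\<close> is preserved by \<open>pp\<close> and \<open>t \<notin> R\<close>. For each \<open>x\<close> consider the weakest clause in \<open>x\<close>
  that fails at \<open>t\<close>: its \<open>y\<close>s are the indices with \<open>t\<^sub>y = t\<^sub>x\<close>, its \<open>z\<close>s those with \<open>t\<^sub>x < t\<^sub>z\<close>. If
  none of these clauses were valid in \<open>R\<close>, every \<open>x\<close> would have a counterexample \<open>r \<in> R\<close>, shifted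
  so that \<open>r\<^sub>x = 0\<close>. Going through the values of \<open>t\<close> from the largest to the smallest, \<open>pp r s\<close>
  puts the block of \<open>x\<close> below the larger entries of \<open>t\<close>, on which it keeps the order of the tuple
  \<open>s\<close> built before. In the end \<open>R\<close> contains a tuple ordered like \<open>t\<close>, hence \<open>t\<close> itself, because
  first-order formulas over the rationals only see the order type of a tuple.
\<close>

section \<open>Order types and the invariance of first-order formulas\<close>

definition same_order_on :: "'i set \<Rightarrow> ('i \<Rightarrow> 'a::linorder) \<Rightarrow> ('i \<Rightarrow> 'b::linorder) \<Rightarrow> bool" where
  "same_order_on A \<sigma> \<tau> \<longleftrightarrow> (\<forall>i\<in>A. \<forall>j\<in>A. \<sigma> i \<le> \<sigma> j \<longleftrightarrow> \<tau> i \<le> \<tau> j)"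

lemma same_order_onD:
  assumes "same_order_on A \<sigma> \<tau>" "i \<in> A" "j \<in> A"
  shows "\<sigma> i \<le> \<sigma> j \<longleftrightarrow> \<tau> i \<le> \<tau> j" "\<sigma> i < \<sigma> j \<longleftrightarrow> \<tau> i < \<tau> j" "\<sigma> i = \<sigma> j \<longleftrightarrow> \<tau> i = \<tau> j"
  using assms unfolding same_order_on_def by (metis linorder_not_le order_antisym order_refl)+

lemma same_order_on_sym: "same_order_on A \<sigma> \<tau> \<Longrightarrow> same_order_on A \<tau> \<sigma>"
  unfolding same_order_on_def by blast

lemma same_order_on_subset: "same_order_on B \<sigma> \<tau> \<Longrightarrow> A \<subseteq> B \<Longrightarrow> same_order_on A \<sigma> \<tau>"
  unfolding same_order_on_def by blast

lemma dense_unbounded_between: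
  fixes L U :: "'a::{dense_linorder, no_top, no_bot} set"
  assumes "finite L" "finite U" and LU: "\<And>l u. l \<in> L \<Longrightarrow> u \<in> U \<Longrightarrow> l < u"
  obtains q where "\<forall>l\<in>L. l < q" "\<forall>u\<in>U. q < u"
proof -
  consider "L = {}" "U = {}" | "L = {}" "U \<noteq> {}" | "L \<noteq> {}" "U = {}" | "L \<noteq> {}" "U \<noteq> {}"
    by blast
  then show thesis
  proof cases
    case 1
    then show ?thesis using that by blast
  next
    case 2
    obtain q where "q < Min U" using lt_ex by blast
    then show ?thesis using that[of q] 2 assms(2) by simp
  next
    case 3
    obtain q where "Max L < q" using gt_ex by blast
    then show ?thesis using that[of q] 3 assms(1) by simp
  next
    case 4
    then have "Max L < Min U" using assms by simp
    then obtain q where "Max L < q" "q < Min U" using dense by blast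
    then show ?thesis using that[of q] 4 assms(1,2) by simp
  qed
qed

text \<open>One step of a back-and-forth argument. A value \<open>q\<close> that \<sigma> already
  takes outside \<open>x\<close> is answered by the corresponding value of \<tau>; any other
  \<open>q\<close> cuts the values of \<sigma> into a lower and an upper part, and \<open>q'\<close>
  is put into the matching cut of \<tau>. Density, and the lack of endpoints when one part is empty,
  provide it.\<close>

lemma same_order_on_extend:
  fixes \<tau> :: "'i \<Rightarrow> 'b::{dense_linorder, no_top, no_bot}"
  assumes "finite A" and so: "same_order_on (A - {x}) \<sigma> \<tau>"
  obtains q' where "same_order_on A (\<sigma>(x := q)) (\<tau>(x := q'))"
proof (cases "\<exists>i\<in>A - {x}. \<sigma> i = q")
  case True
  then obtain i where i: "i \<in> A - {x}" "\<sigma> i = q" by blast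
  have "same_order_on A (\<sigma>(x := q)) (\<tau>(x := \<tau> i))"
    using same_order_onD(1)[OF so] i unfolding same_order_on_def by auto
  then show ?thesis by (rule that)
next
  case False
  let ?L = "\<tau> ` {i \<in> A - {x}. \<sigma> i < q}" and ?U = "\<tau> ` {i \<in> A - {x}. q < \<sigma> i}"
  have less: "l < u" if "l \<in> ?L" "u \<in> ?U" for l u
    using that same_order_onD(2)[OF so] by fastforce
  have fin: "finite ?L" "finite ?U" using \<open>finite A\<close> by simp_all
  obtain q' where q': "\<forall>l\<in>?L. l < q'" "\<forall>u\<in>?U. q' < u"
    by (rule dense_unbounded_between[OF fin less])
  have cmp: "(\<sigma> i \<le> q \<longleftrightarrow> \<tau> i \<le> q') \<and> (q \<le> \<sigma> i \<longleftrightarrow> q' \<le> \<tau> i)" if "i \<in> A" "i \<noteq> x" for i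
  proof (cases "\<sigma> i < q")
    case True
    then have "\<tau> i < q'" using q'(1) that by simp
    with True show ?thesis by auto
  next
    case 2: False
    then have "q < \<sigma> i" using False that by force
    moreover from this have "q' < \<tau> i" using q'(2) that by simp
    ultimately show ?thesis by auto
  qed
  have "same_order_on A (\<sigma>(x := q)) (\<tau>(x := q'))"
    using same_order_onD(1)[OF so] cmp unfolding same_order_on_def by auto
  then show ?thesis by (rule that)
qed

lemma finite_fv: "finite (fv \<phi>)"
  by (induction \<phi>) auto

lemma holds_same_order:
  "same_order_on (fv \<phi>) \<sigma> \<tau> \<Longrightarrow> holds \<sigma> \<phi> \<longleftrightarrow> holds \<tau> \<phi>"
proof (induction \<phi> arbitrary: \<sigma> \<tau>)
  case (Less x y)
  then show ?case by (simp add: same_order_onD(2))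
next
  case (Eq x y)
  then show ?case by (simp add: same_order_onD(3))
next
  case (And \<phi> \<psi>)
  then show ?case by (auto dest: same_order_on_subset)
next
  case (Or \<phi> \<psi>)
  have "same_order_on (fv \<phi>) \<sigma> \<tau>" "same_order_on (fv \<psi>) \<sigma> \<tau>"
    using Or.prems by (auto elim: same_order_on_subset)
  then show ?case using Or.IH by simp
next
  case (Exists x \<phi>)
  have so: "same_order_on (fv \<phi> - {x}) \<sigma> \<tau>" using Exists.prems by simp
  have "\<exists>q'. holds (\<sigma>(x := q)) \<phi> \<longleftrightarrow> holds (\<tau>(x := q')) \<phi>" for q
    using same_order_on_extend[OF finite_fv so] Exists.IH by metis
  \<comment> \<open>The step back, needed because the matching of values has to work from both
    sides.\<close>
  moreover have "\<exists>q. holds (\<sigma>(x := q)) \<phi> \<longleftrightarrow> holds (\<tau>(x := q')) \<phi>" for q'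
    using same_order_on_extend[OF finite_fv same_order_on_sym[OF so]] Exists.IH by metis
  ultimately show ?case by (metis holds.simps(7))
next
  case (Forall x \<phi>)
  have so: "same_order_on (fv \<phi> - {x}) \<sigma> \<tau>" using Forall.prems by simp
  have "\<exists>q'. holds (\<sigma>(x := q)) \<phi> \<longleftrightarrow> holds (\<tau>(x := q')) \<phi>" for q
    using same_order_on_extend[OF finite_fv so] Forall.IH by metis
  moreover have "\<exists>q. holds (\<sigma>(x := q)) \<phi> \<longleftrightarrow> holds (\<tau>(x := q')) \<phi>" for q'
    using same_order_on_extend[OF finite_fv same_order_on_sym[OF so]] Forall.IH by metis
  ultimately show ?case by (metis holds.simps(8))
qed auto

text \<open>From here on \<open>temporal_relation\<close> is used only through this closure under
  order type and through the common length of the tuples.\<close>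

lemma temporal_relation_same_order:
  assumes "temporal_relation m R" "s \<in> R" "length t = m"
    and "same_order_on {..<m} ((!) s) ((!) t)"
  shows "t \<in> R"
proof -
  obtain \<phi> where \<phi>: "fv \<phi> \<subseteq> {..<m}" "R = {t. length t = m \<and> holds (\<lambda>i. t ! i) \<phi>}"
    using assms(1) unfolding temporal_relation_def fo_defines_def by blast
  then have "holds ((!) s) \<phi> \<longleftrightarrow> holds ((!) t) \<phi>"
    using assms(4) holds_same_order same_order_on_subset by blast
  then show ?thesis using \<phi>(2) assms(2,3) by auto
qed

lemma temporal_relation_length: "temporal_relation m R \<Longrightarrow> t \<in> R \<Longrightarrow> length t = m"
  unfolding temporal_relation_def fo_defines_def by auto

section \<open>Semantics of clauses\<close>

lemma holds_Disj: "holds \<sigma> (Disj \<phi>s) \<longleftrightarrow> (\<exists>\<phi>\<in>set \<phi>s. holds \<sigma> \<phi>)"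
  unfolding Disj_def by (induction \<phi>s) auto

lemma holds_Conj: "holds \<sigma> (Conj \<phi>s) \<longleftrightarrow> (\<forall>\<phi>\<in>set \<phi>s. holds \<sigma> \<phi>)"
  unfolding Conj_def by (induction \<phi>s) auto

lemma fv_Disj: "fv (Disj \<phi>s) = (\<Union>\<phi>\<in>set \<phi>s. fv \<phi>)"
  unfolding Disj_def by (induction \<phi>s) auto

lemma fv_Conj: "fv (Conj \<phi>s) = (\<Union>\<phi>\<in>set \<phi>s. fv \<phi>)"
  unfolding Conj_def by (induction \<phi>s) auto

text \<open>This exposes the parameters hidden by the existential quantifier in
  \<open>pp_clause\<close>, so that the clauses can be enumerated within bounds.\<close>

definition clause_of :: "nat \<Rightarrow> nat list \<Rightarrow> nat list \<Rightarrow> fo_formula" where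
  "clause_of x ys zs = Disj (map (Neq x) ys @ map (Geq x) zs)"

lemma holds_clause_of:
  "holds \<sigma> (clause_of x ys zs) \<longleftrightarrow> (\<exists>y\<in>set ys. \<sigma> x \<noteq> \<sigma> y) \<or> (\<exists>z\<in>set zs. \<sigma> z \<le> \<sigma> x)"
  unfolding clause_of_def by (simp add: holds_Disj Neq_def Geq_def le_less bex_Un) metis

lemma fv_clause_of: "fv (clause_of x ys zs) \<subseteq> insert x (set ys \<union> set zs)"
  unfolding clause_of_def by (auto simp: fv_Disj Neq_def Geq_def)

section \<open>Clauses are preserved by pp\<close>

lemma is_pp_le_iff:
  "is_pp f \<Longrightarrow> f a b \<le> f a' b' \<longleftrightarrow> (a \<le> 0 \<and> a \<le> a') \<or> (0 < a \<and> 0 < a' \<and> b \<le> b')"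
  unfolding is_pp_def by blast

lemma is_pp_less_iff:
  "is_pp f \<Longrightarrow> f a b < f a' b' \<longleftrightarrow> (a \<le> 0 \<and> a < a') \<or> (0 < a \<and> 0 < a' \<and> b < b')"
  unfolding linorder_not_le[symmetric, of "f a b"] by (auto simp: is_pp_le_iff)

lemma is_pp_eq_iff:
  "is_pp f \<Longrightarrow> f a b = f a' b' \<longleftrightarrow> (a \<le> 0 \<and> a = a') \<or> (0 < a \<and> 0 < a' \<and> b = b')"
  unfolding order_eq_iff[of "f a b"] by (auto simp: is_pp_le_iff)

text \<open>If the clause fails at the image, then there \<open>x\<close> equals every
  \<open>y\<close> and lies strictly below every \<open>z\<close>. For
  \<open>\<sigma> x \<le> 0\<close> these comparisons are decided by the first arguments, so the
  clause already fails at \<sigma>. Otherwise all first arguments involved are positive, the second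
  ones decide, and it fails at \<tau>.\<close>

lemma holds_pp_clause_pp:
  assumes "is_pp f" "pp_clause c" "holds \<sigma> c" "holds \<tau> c"
  shows "holds (\<lambda>i. f (\<sigma> i) (\<tau> i)) c"
proof -
  obtain x ys zs where c: "c = clause_of x ys zs"
    using assms(2) unfolding pp_clause_def clause_of_def by blast
  show ?thesis
  proof (rule ccontr)
    assume "\<not> ?thesis"
    then have *: "\<forall>y\<in>set ys. f (\<sigma> x) (\<tau> x) = f (\<sigma> y) (\<tau> y)"
      "\<forall>z\<in>set zs. f (\<sigma> x) (\<tau> x) < f (\<sigma> z) (\<tau> z)"
      unfolding c holds_clause_of by (auto simp: not_le)
    show False
    proof (cases "\<sigma> x \<le> 0")
      case True
      then have "\<not> holds \<sigma> c"
        using * unfolding c holds_clause_of is_pp_eq_iff[OF assms(1)] is_pp_less_iff[OF assms(1)]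
        by force
      then show False using assms(3) by blast
    next
      case False
      then have "\<not> holds \<tau> c"
        using * unfolding c holds_clause_of is_pp_eq_iff[OF assms(1)] is_pp_less_iff[OF assms(1)]
        by force
      then show False using assms(4) by blast
    qed
  qed
qed

lemma preserves_pp_if_pp_clauses:
  assumes "is_pp f" "\<forall>c\<in>set cs. pp_clause c" "fo_defines m (Conj cs) R"
  shows "preserves f R"
  unfolding preserves_def
proof (intro ballI)
  fix s t assume st: "s \<in> R" "t \<in> R"
  from assms(3) have fv: "fv (Conj cs) \<subseteq> {..<m}"
    and R: "R = {t. length t = m \<and> holds (\<lambda>i. t ! i) (Conj cs)}"
    unfolding fo_defines_def by auto
  have len: "length s = m" "length t = m" using st R by auto
  have "holds (\<lambda>i. f (s ! i) (t ! i)) (Conj cs)"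
    using st assms(1,2) R by (auto simp: holds_Conj intro: holds_pp_clause_pp)
  \<comment> \<open>The two assignments are known to agree only below \<open>m\<close>, hence the
    detour through the free variables.\<close>
  moreover have "same_order_on (fv (Conj cs)) (\<lambda>i. f (s ! i) (t ! i)) (\<lambda>i. map2 f s t ! i)"
    using fv len unfolding same_order_on_def by (auto simp: subset_iff)
  ultimately have "holds (\<lambda>i. map2 f s t ! i) (Conj cs)"
    using holds_same_order by blast
  then show "map2 f s t \<in> R" using R len by simp
qed

section \<open>From preservation to clauses\<close>

lemma preserves_map2_shift:
  assumes "temporal_relation m R" "preserves f R" "r \<in> R" "s \<in> R"
  shows "map2 f (map (\<lambda>a. a - c) r) s \<in> R"
proof -
  have "length r = m" using assms(1,3) by (rule temporal_relation_length)
  \<comment> \<open>Translation keeps the order type; in effect it moves the threshold 0 of pp to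
    \<open>c\<close>.\<close>
  then have "map (\<lambda>a. a - c) r \<in> R"
    by (intro temporal_relation_same_order[OF assms(1,3)]) (auto simp: same_order_on_def)
  then show ?thesis using assms(2,4) unfolding preserves_def by blast
qed

text \<open>Induction from the largest value of \<open>t\<close> downwards, measured by the number
  of larger entries. Entries below \<open>t ! x\<close> stay uncontrolled, since the counterexample
  for \<open>x\<close> says nothing about them.\<close>

lemma tuple_ordered_above:
  fixes t :: "rat list"
  assumes R: "temporal_relation m R" "is_pp f" "preserves f R"
    and wit: "\<And>x. x < m \<Longrightarrow> \<exists>r\<in>R. (\<forall>y<m. t ! y = t ! x \<longrightarrow> r ! y = r ! x) \<and>
                                 (\<forall>z<m. t ! x < t ! z \<longrightarrow> r ! x < r ! z)"
    and "x < m"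
  shows "\<exists>s\<in>R. same_order_on {i. i < m \<and> t ! x \<le> t ! i} ((!) s) ((!) t)"
  using \<open>x < m\<close>
proof (induction "card {i. i < m \<and> t ! x < t ! i}" arbitrary: x rule: less_induct)
  case less
  obtain r where r: "r \<in> R" "\<And>y. y < m \<Longrightarrow> t ! y = t ! x \<Longrightarrow> r ! y = r ! x"
    "\<And>z. z < m \<Longrightarrow> t ! x < t ! z \<Longrightarrow> r ! x < r ! z"
    using wit[OF less.prems] by blast
  let ?A = "{i. i < m \<and> t ! x < t ! i}"
  show ?case
  proof (cases "?A = {}")
    case True
    then have "t ! i = t ! x" if "i < m" "t ! x \<le> t ! i" for i
      using that by force
    then have "same_order_on {i. i < m \<and> t ! x \<le> t ! i} ((!) r) ((!) t)"
      using r(2) unfolding same_order_on_def by (metis (no_types, lifting) mem_Collect_eq order_refl)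
    then show ?thesis using r(1) by blast
  next
    case False
    \<comment> \<open>The next larger value of \<open>t\<close>: by minimality the induction
      hypothesis for \<open>x'\<close> covers all of \<open>?A\<close>.\<close>
    define x' where "x' = arg_min_on ((!) t) ?A"
    have fin: "finite ?A" by simp
    have x': "x' < m" "t ! x < t ! x'"
      using arg_min_if_finite(1)[OF fin False, of "(!) t"] unfolding x'_def by auto
    have min: "t ! x' \<le> t ! i" if "i < m" "t ! x < t ! i" for i
      using arg_min_least[OF fin False, of i "(!) t"] that unfolding x'_def by auto
    have "card {i. i < m \<and> t ! x' < t ! i} < card ?A"
      using x' by (intro psubset_card_mono) auto
    from less.hyps[OF this x'(1)] obtain s where s: "s \<in> R"
      "same_order_on {i. i < m \<and> t ! x' \<le> t ! i} ((!) s) ((!) t)" by blast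
    \<comment> \<open>After the shift the first argument is 0 on the block of \<open>x\<close> and
      positive on \<open>?A\<close>. So \<open>f\<close> is constant on the block, puts it below
      \<open>?A\<close>, and orders \<open>?A\<close> as \<open>s\<close> does.\<close>
    define u where "u = map2 f (map (\<lambda>a. a - r ! x) r) s"
    have "u \<in> R" unfolding u_def by (rule preserves_map2_shift[OF R(1,3) r(1) s(1)])
    have "length r = m" "length s = m"
      using temporal_relation_length[OF R(1)] r(1) s(1) by auto
    then have u: "u ! i = f (r ! i - r ! x) (s ! i)" if "i < m" for i
      using that unfolding u_def by simp
    have "u ! i \<le> u ! j \<longleftrightarrow> t ! i \<le> t ! j"
      if ij: "i < m" "t ! x \<le> t ! i" "j < m" "t ! x \<le> t ! j" for i j
    proof -
      have pos: "t ! k = t ! x \<and> r ! k = r ! x \<or> t ! x < t ! k \<and> r ! x < r ! k"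
        if "k < m" "t ! x \<le> t ! k" for k
        using r(2,3) that by (metis le_less)
      have "s ! i \<le> s ! j \<longleftrightarrow> t ! i \<le> t ! j" if "t ! x < t ! i" "t ! x < t ! j"
        using same_order_onD(1)[OF s(2)] ij that min by simp
      then show ?thesis
        using pos[OF ij(1,2)] pos[OF ij(3,4)] ij unfolding u[OF ij(1)] u[OF ij(3)] is_pp_le_iff[OF R(2)]
        by auto
    qed
    then have "same_order_on {i. i < m \<and> t ! x \<le> t ! i} ((!) u) ((!) t)"
      unfolding same_order_on_def by simp
    then show ?thesis using \<open>u \<in> R\<close> by blast
  qed
qed

lemma pp_clause_separates:
  assumes R: "temporal_relation m R" "is_pp f" "preserves f R"
    and t: "length t = m" "t \<notin> R" and "R \<noteq> {}"
  obtains x ys zs where "x < m" "set ys \<subseteq> {..<m}" "length ys \<le> m" "set zs \<subseteq> {..<m}" "length zs \<le> m"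
    "\<forall>s\<in>R. holds ((!) s) (clause_of x ys zs)" "\<not> holds ((!) t) (clause_of x ys zs)"
proof (rule ccontr)
  assume "\<not> thesis"
  note none = that this
  have wit: "\<exists>r\<in>R. (\<forall>y<m. t ! y = t ! x \<longrightarrow> r ! y = r ! x) \<and> (\<forall>z<m. t ! x < t ! z \<longrightarrow> r ! x < r ! z)"
    if "x < m" for x
  proof -
    \<comment> \<open>\<open>?ys\<close> contains \<open>x\<close> itself, which only adds a
      disjunct that is never true.\<close>
    let ?ys = "filter (\<lambda>y. t ! y = t ! x) [0..<m]" and ?zs = "filter (\<lambda>z. t ! x < t ! z) [0..<m]"
    have len: "length ?ys \<le> m" "length ?zs \<le> m"
      using length_filter_le[of _ "[0..<m]"] by simp_all
    have "\<not> holds ((!) t) (clause_of x ?ys ?zs)"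
      by (auto simp: holds_clause_of)
    then obtain r where "r \<in> R" "\<not> holds ((!) r) (clause_of x ?ys ?zs)"
      using none(1)[OF \<open>x < m\<close> _ len(1) _ len(2)] none(2) by fastforce
    then have "r \<in> R \<and> (\<forall>y<m. t ! y = t ! x \<longrightarrow> r ! y = r ! x) \<and> (\<forall>z<m. t ! x < t ! z \<longrightarrow> r ! x < r ! z)"
      by (auto simp: holds_clause_of not_le)
    then show ?thesis by blast
  qed
  have "\<exists>s\<in>R. same_order_on {..<m} ((!) s) ((!) t)"
  \<comment> \<open>Without indices there is no \<open>x\<close> to start from, and any element of
    \<open>R\<close> will do. Otherwise the index of a least entry of \<open>t\<close> is taken,
    above which lies the whole tuple.\<close>
  proof (cases "m = 0")
    case True
    then show ?thesis using \<open>R \<noteq> {}\<close> by (auto simp: same_order_on_def)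
  next
    case False
    let ?x = "arg_min_on ((!) t) {..<m}"
    have x: "?x < m" "\<forall>i<m. t ! ?x \<le> t ! i"
      using False arg_min_if_finite(1)[of "{..<m}" "(!) t"] arg_min_least[of "{..<m}" _ "(!) t"]
      by auto
    have "{i. i < m \<and> t ! ?x \<le> t ! i} = {..<m}" using x by auto
    then show ?thesis using tuple_ordered_above[OF R wit x(1)] by simp
  qed
  then show False using temporal_relation_same_order[OF R(1) _ t(1)] t(2) by blast
qed

lemma pp_clauses_if_preserves_pp:
  assumes R: "temporal_relation m R" "is_pp f" "preserves f R"
  shows "\<exists>cs. (\<forall>c\<in>set cs. pp_clause c) \<and> fo_defines m (Conj cs) R"
proof (cases "R = {}")
  case True
  \<comment> \<open>The empty clause is false and has no free variables, so it defines the empty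
    relation even for \<open>m = 0\<close>; the index 0 is a dummy.\<close>
  have "pp_clause (clause_of 0 [] [])"
    unfolding pp_clause_def clause_of_def by blast
  moreover have "fo_defines m (Conj [clause_of 0 [] []]) R"
    using True unfolding fo_defines_def
    by (simp add: holds_Conj fv_Conj holds_clause_of) (simp add: clause_of_def fv_Disj)
  ultimately show ?thesis by (intro exI[of _ "[clause_of 0 [] []]"]) simp
next
  case False
  \<comment> \<open>The length bound makes the set of candidate clauses finite, so all those valid
    in \<open>R\<close> fit into one conjunction.\<close>
  let ?L = "{ys. set ys \<subseteq> {..<m} \<and> length ys \<le> m}"
  let ?K = "(\<lambda>(x, ys, zs). clause_of x ys zs) ` ({..<m} \<times> ?L \<times> ?L)"
  have "finite ?K"
    by (intro finite_imageI finite_cartesian_product finite_lists_length_le finite_lessThan)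
  then have "finite {c \<in> ?K. \<forall>s\<in>R. holds ((!) s) c}" by (rule rev_finite_subset) blast
  from finite_list[OF this]
  obtain cs where cs: "set cs = {c \<in> ?K. \<forall>s\<in>R. holds ((!) s) c}" ..
  have "pp_clause c" if "c \<in> set cs" for c
    using that unfolding cs pp_clause_def clause_of_def by auto
  moreover have "fv (Conj cs) \<subseteq> {..<m}"
    unfolding fv_Conj cs using fv_clause_of by fastforce
  moreover have "t \<in> R \<longleftrightarrow> length t = m \<and> holds ((!) t) (Conj cs)" for t
  proof
    assume "t \<in> R"
    then show "length t = m \<and> holds ((!) t) (Conj cs)"
      using temporal_relation_length[OF R(1)] by (auto simp: holds_Conj cs)
  next
    assume t: "length t = m \<and> holds ((!) t) (Conj cs)"
    show "t \<in> R"
    proof (rule ccontr)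
      assume "t \<notin> R"
      from pp_clause_separates[OF R conjunct1[OF t] this False]
      obtain x ys zs where *: "x < m" "set ys \<subseteq> {..<m}" "length ys \<le> m"
        "set zs \<subseteq> {..<m}" "length zs \<le> m" "\<forall>s\<in>R. holds ((!) s) (clause_of x ys zs)"
        "\<not> holds ((!) t) (clause_of x ys zs)" .
      then have "(x, ys, zs) \<in> {..<m} \<times> ?L \<times> ?L" by simp
      then have "clause_of x ys zs \<in> ?K" by (rule rev_image_eqI) simp
      with * have "clause_of x ys zs \<in> set cs" unfolding cs by simp
      with t *(7) show False by (simp add: holds_Conj)
    qed
  qed
  ultimately show ?thesis unfolding fo_defines_def by blast
qed

theorem theorem3p2:
  fixes m :: nat and R :: "rat list set" and pp :: "rat \<Rightarrow> rat \<Rightarrow> rat"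
  assumes "temporal_relation m R" and "is_pp pp"
  shows "preserves pp R \<longleftrightarrow>
    (\<exists>cs. (\<forall>c\<in>set cs. pp_clause c) \<and> fo_defines m (Conj cs) R)"
  using pp_clauses_if_preserves_pp[OF assms] preserves_pp_if_pp_clauses[OF assms(2)] by blast

end
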